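(* Let $\mathbb K$ be a field of characteristic different from $2$, let $\mathfrak g$ be a $\mathbb K$-vector space and let $\pi_1,\pi_2\in\mathrm{Hom}(\otimes^2\mathfrak g,\mathfrak g)$. Then $(\mathfrak g,\pi_1,\pi_2)$ is a compatible pre-Lie algebra if and only if $(\pi_1,\pi_2)$ is a Maurer-Cartan element of the bidifferential graded Lie algebra $(C^*(\mathfrak g;\mathfrak g),[\cdot,\cdot]^{MN},\mathrm d_1=0,\mathrm d_2=0)$.
   Context: Pre-Lie algebra: a vector space $\mathfrak g$ with a bilinear product $\cdot$ satisfying $(x\cdot y)\cdot z-x\cdot(y\cdot z)=(y\cdot x)\cdot z-y\cdot(x\cdot z)$ for all $x,y,z$. Compatible pre-Lie algebra: a triple $(\mathfrak g,\cdot,\ast)$ where $\cdot$ and $\ast$ are pre-Lie products on $\mathfrak g$ such that for all $x,y,z\in\mathfrak g$: $(x\ast y)\cdot z+(x\cdot y)\ast z-x\cdot(y\ast z)-x\ast(y\cdot z)-(y\ast x)\cdot z-(y\cdot x)\ast z+y\cdot(x\ast z)+y\ast(x\cdot z)=0$. Here $(\mathfrak g,\pi_1,\pi_2)$ means $x\cdot y=\pi_1(x,y)$, $x\ast y=\pi_2(x,y)$. Graded Lie algebra: $C^n(\mathfrak g;\mathfrak g)=\mathrm{Hom}(\wedge^{n-1}\mathfrak g\otimes\mathfrak g,\mathfrak g)$, $C^*(\mathfrak g;\mathfrak g)=\oplus_{n\ge1}C^n(\mathfrak g;\mathfrak g)$, where $C^{p+1}(\mathfrak g;\mathfrak g)$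 has degree $p$. The Matsushima-Nijenhuis bracket is $[P,Q]^{MN}=P\circ Q-(-1)^{pq}Q\circ P$ for $P\in C^{p+1}(\mathfrak g;\mathfrak g)$, $Q\in C^{q+1}(\mathfrak g;\mathfrak g)$, where $P\circ Q\in C^{p+q+1}(\mathfrak g;\mathfrak g)$ is $$(P\circ Q)(x_1,\dots,x_{p+q+1})=\sum_{\sigma\in\mathbb S_{(q,1,p-1)}}\mathrm{sgn}(\sigma)P(Q(x_{\sigma(1)},\dots,x_{\sigma(q)},x_{\sigma(q+1)}),x_{\sigma(q+2)},\dots,x_{\sigma(p+q)},x_{p+q+1})$$ $$+(-1)^{pq}\sum_{\sigma\in\mathbb S_{(p,q)}}\mathrm{sgn}(\sigma)P(x_{\sigma(1)},\dots,x_{\sigma(p)},Q(x_{\sigma(p+1)},\dots,x_{\sigma(p+q)},x_{p+q+1})).$$ Here $\mathbb S_{(i_1,\dots,i_k)}$ is the set of $(i_1,\dots,i_k)$-unshuffles (permutations of $\{1,\dots,i_1+\dots+i_k\}$ increasing on each consecutive block of lengths $i_1,\dots,i_k$); the first sum is empty if $p=0$. It is known that $(C^*(\mathfrak g;\mathfrak g),[\cdot,\cdot]^{MN})$ is a graded Lie algebra. A bidifferential graded Lie algebra $(\mathcal G,[\cdot,\cdot],\mathrm d_1,\mathrm d_2)$ is a graded Lie algebra $\mathcal G=\oplus_{i\ge0}\mathfrak g_i$ with two differentials $\mathrm d_1,\mathrm d_2$, each making it a differential graded Lie algebra, such that $\mathrm d_1\mathrm d_2+\mathrm d_2\mathrm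 d_1=0$. A pair $(P_1,P_2)\in\mathfrak g_1\oplus\mathfrak g_1$ is a Maurer-Cartan element if $\mathrm d_1P_1+\frac12[P_1,P_1]=0$, $\mathrm d_2P_2+\frac12[P_2,P_2]=0$ and $\mathrm d_1P_2+\mathrm d_2P_1+[P_1,P_2]=0$. *)

theory Defs
  imports Complex_Main "HOL-Combinatorics.Permutations" "HOL-Library.Function_Algebras"
begin

definition bilinear_map :: "('k::field \<Rightarrow> 'g::ab_group_add \<Rightarrow> 'g) \<Rightarrow> ('g \<Rightarrow> 'g \<Rightarrow> 'g) \<Rightarrow> bool" where
  "bilinear_map scale m \<longleftrightarrow>
     (\<forall>x. Vector_Spaces.linear scale scale (\<lambda>y. m x y)) \<and>
     (\<forall>y. Vector_Spaces.linear scale scale (\<lambda>x. m x y))"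

definition pre_lie_algebra :: "('k::field \<Rightarrow> 'g::ab_group_add \<Rightarrow> 'g) \<Rightarrow> ('g \<Rightarrow> 'g \<Rightarrow> 'g) \<Rightarrow> bool" where
  "pre_lie_algebra scale m \<longleftrightarrow>
     vector_space scale \<and> bilinear_map scale m \<and>
     (\<forall>x y z. m (m x y) z - m x (m y z) = m (m y x) z - m y (m x z))"

definition compatible_pre_lie_algebra ::
  "('k::field \<Rightarrow> 'g::ab_group_add \<Rightarrow> 'g) \<Rightarrow> ('g \<Rightarrow> 'g \<Rightarrow> 'g) \<Rightarrow> ('g \<Rightarrow> 'g \<Rightarrow> 'g) \<Rightarrow> bool" where
  "compatible_pre_lie_algebra scale m1 m2 \<longleftrightarrow>
     pre_lie_algebra scale m1 \<and> pre_lie_algebra scale m2 \<and>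
     (\<forall>x y z. m1 (m2 x y) z + m2 (m1 x y) z - m1 x (m2 y z) - m2 x (m1 y z)
            - m1 (m2 y x) z - m2 (m1 y x) z + m1 y (m2 x z) + m2 y (m1 x z) = 0)"

text \<open>
  A graded Lie algebra is an internal direct sum: its homogeneous components are subspaces
  \<open>G i\<close> of an ambient vector space, and the algebra itself is the span of their union.
\<close>

locale graded_lie_algebra = vector_space scale
  for scale :: "'k::field \<Rightarrow> 'a::ab_group_add \<Rightarrow> 'a" +
  fixes G :: "nat \<Rightarrow> 'a set"
    and bracket :: "'a \<Rightarrow> 'a \<Rightarrow> 'a"
  assumes subspace_component: "subspace (G i)"
    and direct: "finite I \<Longrightarrow> (\<And>i. i \<in> I \<Longrightarrow> f i \<in> G i) \<Longrightarrow> (\<Sum>i\<in>I. f i) = 0 \<Longrightarrow> j \<in> I \<Longrightarrow> f j = 0"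
    and bracket_add_left: "x \<in> span (\<Union>i. G i) \<Longrightarrow> y \<in> span (\<Union>i. G i) \<Longrightarrow> z \<in> span (\<Union>i. G i) \<Longrightarrow>
           bracket (x + y) z = bracket x z + bracket y z"
    and bracket_add_right: "x \<in> span (\<Union>i. G i) \<Longrightarrow> y \<in> span (\<Union>i. G i) \<Longrightarrow> z \<in> span (\<Union>i. G i) \<Longrightarrow>
           bracket z (x + y) = bracket z x + bracket z y"
    and bracket_scale_left: "x \<in> span (\<Union>i. G i) \<Longrightarrow> y \<in> span (\<Union>i. G i) \<Longrightarrow>
           bracket (scale c x) y = scale c (bracket x y)"
    and bracket_scale_right: "x \<in> span (\<Union>i. G i) \<Longrightarrow> y \<in> span (\<Union>i. G i) \<Longrightarrow>
           bracket x (scale c y) = scale c (bracket x y)"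
    and bracket_degree: "x \<in> G i \<Longrightarrow> y \<in> G j \<Longrightarrow> bracket x y \<in> G (i + j)"
    and graded_antisymmetry: "x \<in> G i \<Longrightarrow> y \<in> G j \<Longrightarrow>
           bracket x y = - scale ((-1) ^ (i * j)) (bracket y x)"
    and graded_jacobi: "x \<in> G i \<Longrightarrow> y \<in> G j \<Longrightarrow> z \<in> G l \<Longrightarrow>
           bracket x (bracket y z) =
             bracket (bracket x y) z + scale ((-1) ^ (i * j)) (bracket y (bracket x z))"

locale differential_graded_lie_algebra = graded_lie_algebra scale G bracket
  for scale :: "'k::field \<Rightarrow> 'a::ab_group_add \<Rightarrow> 'a" and G bracket +
  fixes d :: "'a \<Rightarrow> 'a"
  assumes d_add: "x \<in> span (\<Union>i. G i) \<Longrightarrow> y \<in> span (\<Union>i. G i) \<Longrightarrow> d (x + y) = d x + d y"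
    and d_scale: "x \<in> span (\<Union>i. G i) \<Longrightarrow> d (scale c x) = scale c (d x)"
    and d_degree: "x \<in> G i \<Longrightarrow> d x \<in> G (Suc i)"
    and d_square: "x \<in> G i \<Longrightarrow> d (d x) = 0"
    and d_derivation: "x \<in> G i \<Longrightarrow> y \<in> G j \<Longrightarrow>
           d (bracket x y) = bracket (d x) y + scale ((-1) ^ i) (bracket x (d y))"

locale bidifferential_graded_lie_algebra =
  D1: differential_graded_lie_algebra scale G bracket d1 +
  D2: differential_graded_lie_algebra scale G bracket d2
  for scale :: "'k::field \<Rightarrow> 'a::ab_group_add \<Rightarrow> 'a" and G bracket d1 d2 +
  assumes anticommute: "x \<in> G i \<Longrightarrow> d1 (d2 x) + d2 (d1 x) = 0"

text \<open>
  The Maurer--Cartan equations only involve the data of a bidifferential graded Lie algebra, so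
  the predicate is defined on these data; it is meant to be used when they satisfy
  \<open>bidifferential_graded_lie_algebra\<close>.
\<close>

definition maurer_cartan ::
  "('k::field \<Rightarrow> 'a::ab_group_add \<Rightarrow> 'a) \<Rightarrow> (nat \<Rightarrow> 'a set) \<Rightarrow> ('a \<Rightarrow> 'a \<Rightarrow> 'a) \<Rightarrow>
   ('a \<Rightarrow> 'a) \<Rightarrow> ('a \<Rightarrow> 'a) \<Rightarrow> 'a \<times> 'a \<Rightarrow> bool" where
  "maurer_cartan scale G bracket d1 d2 = (\<lambda>(P1, P2).
     P1 \<in> G 1 \<and> P2 \<in> G 1 \<and>
     d1 P1 + scale (1 / 2) (bracket P1 P1) = 0 \<and>
     d2 P2 + scale (1 / 2) (bracket P2 P2) = 0 \<and>
     d1 P2 + d2 P1 + bracket P1 P2 = 0)"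

text \<open>
  An \<open>n\<close>-ary map is a function on lists that vanishes on lists of length other than \<open>n\<close>.
  The spaces of \<open>n\<close>-ary maps for varying \<open>n\<close> are then independent subspaces of the
  functions on lists, and finite sums of cochains of different degrees live in the same type.
  \<open>cochains scale n\<close> is \<open>Hom(\<Lambda>\<^sup>n\<^sup>-\<^sup>1 g \<otimes> g, g)\<close> for \<open>n \<ge> 1\<close>: multilinear maps that are
  alternating in the first \<open>n - 1\<close> arguments.
\<close>

definition cochains :: "('k::field \<Rightarrow> 'g::ab_group_add \<Rightarrow> 'g) \<Rightarrow> nat \<Rightarrow> ('g list \<Rightarrow> 'g) set" where
  "cochains scale n = {f.
     (\<forall>xs. length xs \<noteq> n \<longrightarrow> f xs = 0) \<and>
     (\<forall>xs i. length xs = n \<longrightarrow> i < n \<longrightarrow>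
        Vector_Spaces.linear scale scale (\<lambda>x. f (xs[i := x]))) \<and>
     (\<forall>xs i j. length xs = n \<longrightarrow> i < j \<longrightarrow> j < n - 1 \<longrightarrow> xs ! i = xs ! j \<longrightarrow> f xs = 0)}"

definition cochain_scale :: "('k \<Rightarrow> 'g \<Rightarrow> 'g) \<Rightarrow> 'k \<Rightarrow> ('g list \<Rightarrow> 'g) \<Rightarrow> 'g list \<Rightarrow> 'g" where
  "cochain_scale scale c f = (\<lambda>xs. scale c (f xs))"

definition cochain_of_product :: "('g \<Rightarrow> 'g \<Rightarrow> 'g::zero) \<Rightarrow> 'g list \<Rightarrow> 'g" where
  "cochain_of_product m = (\<lambda>xs. if length xs = 2 then m (xs ! 0) (xs ! 1) else 0)"

text \<open>Permutations, and the entries of argument lists, are indexed from \<open>0\<close>.\<close>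

definition unshuffles :: "nat list \<Rightarrow> (nat \<Rightarrow> nat) set" where
  "unshuffles ks = {\<sigma>. \<sigma> permutes {..<sum_list ks} \<and>
     (\<forall>b<length ks. strict_mono_on {sum_list (take b ks)..<sum_list (take (Suc b) ks)} \<sigma>)}"

text \<open>The product \<open>P \<circ> Q\<close> for \<open>P\<close> of degree \<open>p\<close> and \<open>Q\<close> of degree \<open>q\<close>.\<close>

definition mn_circ ::
  "('k::field \<Rightarrow> 'g::ab_group_add \<Rightarrow> 'g) \<Rightarrow> nat \<Rightarrow> nat \<Rightarrow>
   ('g list \<Rightarrow> 'g) \<Rightarrow> ('g list \<Rightarrow> 'g) \<Rightarrow> 'g list \<Rightarrow> 'g" where
  "mn_circ scale p q P Q = (\<lambda>xs.
     if length xs \<noteq> p + q + 1 then 0 else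
     (if p = 0 then 0 else
        (\<Sum>\<sigma>\<in>unshuffles [q, 1, p - 1]. scale (of_int (sign \<sigma>))
           (P (Q (map (\<lambda>i. xs ! \<sigma> i) [0..<q + 1])
               # map (\<lambda>i. xs ! \<sigma> i) [q + 1..<p + q] @ [xs ! (p + q)])))) +
     scale ((-1) ^ (p * q))
       (\<Sum>\<sigma>\<in>unshuffles [p, q]. scale (of_int (sign \<sigma>))
          (P (map (\<lambda>i. xs ! \<sigma> i) [0..<p]
              @ [Q (map (\<lambda>i. xs ! \<sigma> i) [p..<p + q] @ [xs ! (p + q)])]))))"

text \<open>
  The bracket on the whole direct sum. A pair of degrees \<open>(p, q)\<close> contributes to an argument list
  \<open>xs\<close> only if \<open>p + q + 1 = length xs\<close>, and \<open>mn_circ scale p q P Q\<close> only evaluates \<open>P\<close> on lists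
  of length \<open>p + 1\<close> and \<open>Q\<close> on lists of length \<open>q + 1\<close>; so the sum below is the bilinear extension
  of the bracket of homogeneous elements (see \<open>mn_bracket_homogeneous\<close>).
\<close>

definition mn_bracket ::
  "('k::field \<Rightarrow> 'g::ab_group_add \<Rightarrow> 'g) \<Rightarrow>
   ('g list \<Rightarrow> 'g) \<Rightarrow> ('g list \<Rightarrow> 'g) \<Rightarrow> 'g list \<Rightarrow> 'g" where
  "mn_bracket scale P Q = (\<lambda>xs.
     \<Sum>(p, q) | p + q + 1 = length xs.
       mn_circ scale p q P Q xs - scale ((-1) ^ (p * q)) (mn_circ scale q p Q P xs))"

lemma cochain_of_product_in_cochains:
  assumes "bilinear_map scale m"
  shows "cochain_of_product m \<in> cochains scale 2"
proof -
  have "Vector_Spaces.linear scale scale (\<lambda>x. cochain_of_product m (xs[i := x]))"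
    if "length xs = 2" "i < 2" for xs i
  proof -
    from that(2) consider "i = 0" | "i = 1" by linarith
    then show ?thesis
      using assms that(1) by cases (simp_all add: bilinear_map_def cochain_of_product_def)
  qed
  then show ?thesis
    by (simp add: cochains_def cochain_of_product_def)
qed

lemma mn_circ_zero:
  assumes "vector_space scale"
    and P: "P \<in> cochains scale (p + 1)" and Q: "Q \<in> cochains scale (q + 1)"
    and ne: "(p', q') \<noteq> (p, q)"
  shows "mn_circ scale p' q' P Q xs = 0"
proof -
  interpret vector_space scale by fact
  show ?thesis
  proof (cases "p' = p")
    case False
    with P have "P ys = 0" if "length ys = p' + 1" for ys
      using that by (simp add: cochains_def)
    then show ?thesis by (auto simp: mn_circ_def intro!: sum.neutral)
  next
    case True
    with ne have "q' \<noteq> q" by simp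
    with Q have Q0: "Q ys = 0" if "length ys = q' + 1" for ys
      using that by (simp add: cochains_def)
    have P0: "P (ys[i := 0]) = 0" if "length ys = p + 1" "i < p + 1" for ys i
    proof -
      from P that have "Vector_Spaces.linear scale scale (\<lambda>x. P (ys[i := x]))"
        by (auto simp: cochains_def)
      then interpret L: Vector_Spaces.linear scale scale "\<lambda>x. P (ys[i := x])" .
      show ?thesis by (rule L.zero)
    qed
    have first: "P (0 # ys) = 0" if "length ys = p" for ys
      using P0[of "0 # ys" 0] that by simp
    have last: "P (ys @ [0]) = 0" if "length ys = p" for ys
      using P0[of "ys @ [0]" p] that by (auto simp: list_update_append)
    show ?thesis
      using True by (auto simp: mn_circ_def Q0 first last intro!: sum.neutral)
  qed
qed

lemma mn_bracket_homogeneous: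
  assumes vs: "vector_space scale"
    and P: "P \<in> cochains scale (p + 1)" and Q: "Q \<in> cochains scale (q + 1)"
  shows "mn_bracket scale P Q =
           mn_circ scale p q P Q - cochain_scale scale ((-1) ^ (p * q)) (mn_circ scale q p Q P)"
proof
  fix xs
  interpret vector_space scale by fact
  let ?t = "\<lambda>(p, q). mn_circ scale p q P Q xs - scale ((-1) ^ (p * q)) (mn_circ scale q p Q P xs)"
  let ?A = "{(p, q). p + q + 1 = length xs}"
  have fin: "finite ?A"
    by (rule finite_subset[of _ "{..length xs} \<times> {..length xs}"]) auto
  have z: "?t pq = 0" if "pq \<noteq> (p, q)" for pq
  proof -
    obtain p' q' where "pq = (p', q')" by force
    with that show ?thesis
      using mn_circ_zero[OF vs P Q, of p' q' xs] mn_circ_zero[OF vs Q P, of q' p' xs] by auto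
  qed
  have "mn_bracket scale P Q xs = sum ?t ?A"
    by (simp add: mn_bracket_def)
  also have "\<dots> = ?t (p, q)"
  proof (cases "(p, q) \<in> ?A")
    case True
    then have "sum ?t ?A = ?t (p, q) + sum ?t (?A - {(p, q)})"
      using fin by (subst sum.remove) auto
    also have "sum ?t (?A - {(p, q)}) = 0"
      by (rule sum.neutral) (use z in blast)
    finally show ?thesis by simp
  next
    case False
    then have "sum ?t ?A = 0"
      by (intro sum.neutral ballI z) auto
    also from False have "0 = ?t (p, q)"
      by (auto simp: mn_circ_def)
    finally show ?thesis .
  qed
  finally show "mn_bracket scale P Q xs =
    (mn_circ scale p q P Q - cochain_scale scale ((-1) ^ (p * q)) (mn_circ scale q p Q P)) xs"
    by (simp add: cochain_scale_def fun_diff_def)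
qed

lemma (in graded_lie_algebra) bidifferential_zero:
  "bidifferential_graded_lie_algebra scale G bracket (\<lambda>_. 0) (\<lambda>_. 0)"
proof -
  have zero: "bracket 0 y = 0" "bracket y 0 = 0" if "y \<in> G i" for y i
  proof -
    have y: "y \<in> span (\<Union>i. G i)" using that by (intro span_base) blast
    show "bracket 0 y = 0" "bracket y 0 = 0"
      using bracket_scale_left[OF y y, of 0] bracket_scale_right[OF y y, of 0] by simp_all
  qed
  show ?thesis
    by unfold_locales (auto simp: zero subspace_0[OF subspace_component])
qed

end

theory Submission
  imports Defs
begin

text \<open>Both differentials are zero, so the Maurer-Cartan equations say that three brackets of
  the degree-1 elements given by \<open>\<pi>1\<close> and \<open>\<pi>2\<close> vanish. In degree 1
  the sign (-1)^(pq) is -1, so the bracket is the symmetric sum of P \<circ> Q and Q \<circ> P.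
  Evaluated on a triple, the mixed bracket is exactly the compatibility expression
  (\<open>mn_bracket_products\<close>). The bracket of a product with itself is twice a(x,y,z) -
  a(y,x,z), with a the associator, so where 2 is invertible it vanishes exactly for pre-Lie products
  (\<open>pre_lie_algebra_iff_mn_bracket\<close>).\<close>

lemma permutes_lessThan_2_iff:
  "\<sigma> permutes {..<Suc (Suc 0)} \<longleftrightarrow> \<sigma> = id \<or> \<sigma> = transpose 0 (Suc 0)"
proof -
  have "{..<Suc (Suc 0)} = {0, Suc 0}" by auto
  then show ?thesis by (simp add: permutes_doubleton_iff)
qed

text \<open>Blocks of length at most one impose no monotonicity, so every permutation of two points
  is an unshuffle.\<close>

lemma unshuffles_1_1: "unshuffles [1, 1] = {id, transpose 0 1}"
  by (auto simp: unshuffles_def permutes_lessThan_2_iff less_Suc_eq strict_mono_on_def)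

lemma unshuffles_1_1_0: "unshuffles [1, 1, 0] = {id, transpose 0 1}"
  by (auto simp: unshuffles_def permutes_lessThan_2_iff less_Suc_eq strict_mono_on_def)

text \<open>Each sum of the composition has two terms of opposite sign, and (-1)^(1*1) negates the
  second sum. For m = m' the result is a(x,y,z) - a(y,x,z).\<close>

lemma mn_circ_products:
  assumes "vector_space scale"
  shows "mn_circ scale 1 1 (cochain_of_product m) (cochain_of_product m') [x, y, z] =
    m (m' x y) z - m (m' y x) z - m x (m' y z) + m y (m' x z)"
proof -
  interpret vector_space scale by fact
  \<comment> \<open>Distinctness lets the sum over the two-element set split into two terms.\<close>
  have "id \<noteq> transpose 0 (1::nat)" by (metis id_apply transpose_apply_first zero_neq_one)
  moreover have "[0..<1] = [0]" "[0..<2] = [0, 1]" "[1..<2] = [1]" "[2..<2] = []"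
    by (simp_all add: upt_rec)
  ultimately show ?thesis
    unfolding mn_circ_def
    by (simp add: unshuffles_1_1[simplified] unshuffles_1_1_0[simplified] sign_swap_id
        cochain_of_product_def numeral_2_eq_2 del: upt_Suc)
qed

text \<open>Both compositions vanish by definition on lists of length other than 3, so equality with
  the zero function is an identity on triples.\<close>

lemma mn_bracket_products:
  assumes vs: "vector_space scale" and m: "bilinear_map scale m" and m': "bilinear_map scale m'"
  shows "mn_bracket scale (cochain_of_product m) (cochain_of_product m') = 0 \<longleftrightarrow>
    (\<forall>x y z. m (m' x y) z + m' (m x y) z - m x (m' y z) - m' x (m y z)
       - m (m' y x) z - m' (m y x) z + m y (m' x z) + m' y (m x z) = 0)"
    (is "?b = 0 \<longleftrightarrow> (\<forall>x y z. ?c x y z = 0)")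
proof -
  interpret vector_space scale by fact
  \<comment> \<open>Arity 2 is written \<open>1 + 1\<close> to match
    \<open>mn_bracket_homogeneous\<close> with p = q = 1.\<close>
  have coch: "cochain_of_product m \<in> cochains scale (1 + 1)"
    "cochain_of_product m' \<in> cochains scale (1 + 1)"
    using m m' cochain_of_product_in_cochains by (simp_all only: one_add_one)
  have b: "?b xs = mn_circ scale 1 1 (cochain_of_product m) (cochain_of_product m') xs
      + mn_circ scale 1 1 (cochain_of_product m') (cochain_of_product m) xs" for xs
    unfolding mn_bracket_homogeneous[OF vs coch] by (simp add: cochain_scale_def)
  have "?b [x, y, z] = ?c x y z" for x y z
    by (simp only: b mn_circ_products[OF vs]) (simp add: algebra_simps)
  moreover have "?b xs = 0" if "length xs \<noteq> 3" for xs
    using that by (simp add: b mn_circ_def)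
  moreover have "\<exists>x y z. xs = [x, y, z]" if "length xs = 3" for xs :: "'b list"
    using that by (auto simp: numeral_3_eq_3 length_Suc_conv)
  ultimately have "?b xs = 0" if "\<forall>x y z. ?c x y z = 0" for xs
    using that by metis
  then show ?thesis
    using \<open>\<And>x y z. ?b [x, y, z] = ?c x y z\<close> by (metis ext zero_fun_apply)
qed

text \<open>For m = m' the terms of the compatibility expression coincide in pairs, and the
  resulting factor 2 can be cancelled.\<close>

lemma pre_lie_algebra_iff_mn_bracket:
  fixes scale :: "'k::field \<Rightarrow> 'g::ab_group_add \<Rightarrow> 'g"
  assumes two: "(2::'k) \<noteq> 0" and vs: "vector_space scale" and m: "bilinear_map scale m"
  shows "pre_lie_algebra scale m \<longleftrightarrow>
    mn_bracket scale (cochain_of_product m) (cochain_of_product m) = 0"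
proof -
  interpret vector_space scale by fact
  have double: "a + a = 0 \<longleftrightarrow> a = 0" for a :: 'g
    using two scale_left_distrib[of 1 1 a] scale_eq_0_iff[of 2 a] by simp
  have "m (m x y) z + m (m x y) z - m x (m y z) - m x (m y z)
      - m (m y x) z - m (m y x) z + m y (m x z) + m y (m x z) = 0 \<longleftrightarrow>
      m (m x y) z - m x (m y z) = m (m y x) z - m y (m x z)" for x y z
    using double[of "m (m x y) z - m x (m y z) - (m (m y x) z - m y (m x z))"]
    by (simp add: algebra_simps)
  then show ?thesis
    unfolding mn_bracket_products[OF vs m m] pre_lie_algebra_def using vs m by simp
qed

theorem theorem2p14:
  fixes scale :: "'k::field \<Rightarrow> 'g::ab_group_add \<Rightarrow> 'g"
    and \<pi>1 \<pi>2 :: "'g \<Rightarrow> 'g \<Rightarrow> 'g"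
  assumes "CHAR('k) \<noteq> 2"
    and "vector_space scale"
    and "bilinear_map scale \<pi>1"
    and "bilinear_map scale \<pi>2"
  shows "compatible_pre_lie_algebra scale \<pi>1 \<pi>2 \<longleftrightarrow>
    maurer_cartan (cochain_scale scale) (\<lambda>i. cochains scale (i + 1)) (mn_bracket scale)
      (\<lambda>_. 0) (\<lambda>_. 0) (cochain_of_product \<pi>1, cochain_of_product \<pi>2)"
proof -
  interpret vector_space scale by fact
  have two: "(2::'k) \<noteq> 0"
  proof
    assume "(2::'k) = 0"
    then have "CHAR('k) dvd 2"
      using of_nat_eq_0_iff_char_dvd[of 2, where 'a = 'k] by simp
    \<comment> \<open>Characteristic 0 is excluded because 0 does not divide 2; a field cannot have
      characteristic 1.\<close>
    then have "CHAR('k) = 1 \<or> CHAR('k) = 2"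
      using dvd_imp_le[of "CHAR('k)" 2] dvd_0_left[of 2] by (cases "CHAR('k) = 0") (simp, linarith)
    with assms(1) show False by simp
  qed
  \<comment> \<open>The scalar 1/2 is nonzero because 2 is; division by zero would have made it
    0.\<close>
  have half: "cochain_scale scale (1 / 2) f = 0 \<longleftrightarrow> f = 0" for f :: "'g list \<Rightarrow> 'g"
    using two by (auto simp: cochain_scale_def fun_eq_iff)
  have coch: "cochain_of_product m \<in> cochains scale (1 + 1)" if "bilinear_map scale m" for m
    using cochain_of_product_in_cochains[OF that] by (simp only: one_add_one)
  \<comment> \<open>The three clauses of compatibility turn into the three bracket equations, one
    for one.\<close>
  show ?thesis
    unfolding compatible_pre_lie_algebra_def maurer_cartan_def
      pre_lie_algebra_iff_mn_bracket[OF two assms(2,3)]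
      pre_lie_algebra_iff_mn_bracket[OF two assms(2,4)]
      mn_bracket_products[OF assms(2-4), symmetric]
    by (simp only: prod.case coch[OF assms(3)] coch[OF assms(4)] half add_0 simp_thms)
qed

end
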